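(* Let $G=(V,E,A)$ be a mixed graph. For every non-negative integer $t$, $(-1)^{|V|}\chi_G(-t)$ equals the number of $t$-colorings of $G$, each counted with multiplicity equal to the number of compatible acyclic orientations of $G$.
   Context: A mixed graph $G=(V,E,A)$ has a finite vertex set $V$, a set $E$ of undirected edges $\{v,w\}$ and a set $A$ of directed edges $(v,w)$; it is assumed to be simple, i.e. it contains neither multiple edges nor loops. Write $[t]=\{1,2,\dots,t\}$. A $t$-coloring of $G$ is a map $c:V\to[t]$ (arbitrary, not necessarily proper). A $t$-coloring is proper if $c(v)\ne c(w)$ for all $\{v,w\}\in E$ and $c(v)<c(w)$ for all $(v,w)\in A$. $\chi_G(t)$ denotes the number of proper $t$-colorings of $G$; this function agrees with a polynomial in $t$, and $\chi_G(-t)$ denotes the evaluation of that polynomial at $-t$. An orientation of $G$ is obtained by keeping each directed edge and orienting each undirected edge; it is acyclic if it contains no coherently-oriented cycle. A coloring $c$ and an orientation of $G$ are compatible if $c(u)\le c(v)$ for every edge oriented $u\to v$ in the orientation. *)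

theory Defs
  imports Complex_Main "HOL-Library.FuncSet" "HOL-Library.Infinite_Set"
    "HOL-Computational_Algebra.Polynomial"
begin

text \<open>
  An undirected edge is a two-element set \<open>{v, w}\<close>, a directed edge an ordered pair
  \<open>(v, w)\<close>. Simplicity means that any two distinct vertices are joined by at most one edge
  of either kind; hence the last two assumptions also exclude antiparallel directed edges
  and an undirected edge parallel to a directed one.
\<close>

locale mixed_graph =
  fixes V :: "'a set" and E :: "'a set set" and A :: "('a \<times> 'a) set"
  assumes finite_V: "finite V"
    and E_edges: "\<And>e. e \<in> E \<Longrightarrow> \<exists>v\<in>V. \<exists>w\<in>V. v \<noteq> w \<and> e = {v, w}"
    and A_edges: "\<And>v w. (v, w) \<in> A \<Longrightarrow> v \<in> V \<and> w \<in> V \<and> v \<noteq> w"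
    and A_A_simple: "\<And>v w. (v, w) \<in> A \<Longrightarrow> (w, v) \<notin> A"
    and E_A_simple: "\<And>v w. (v, w) \<in> A \<Longrightarrow> {v, w} \<notin> E"

definition colorings :: "'a set \<Rightarrow> nat \<Rightarrow> ('a \<Rightarrow> nat) set" where
  "colorings V t = (V \<rightarrow>\<^sub>E {1..t})"

definition proper :: "'a set set \<Rightarrow> ('a \<times> 'a) set \<Rightarrow> ('a \<Rightarrow> nat) \<Rightarrow> bool" where
  "proper E A c \<longleftrightarrow>
     (\<forall>v w. {v, w} \<in> E \<longrightarrow> c v \<noteq> c w) \<and> (\<forall>v w. (v, w) \<in> A \<longrightarrow> c v < c w)"

definition num_proper_colorings ::
    "'a set \<Rightarrow> 'a set set \<Rightarrow> ('a \<times> 'a) set \<Rightarrow> nat \<Rightarrow> nat" where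
  "num_proper_colorings V E A t = card {c \<in> colorings V t. proper E A c}"

text \<open>The description below is meaningful by lemma \<open>ex1_chromatic_poly\<close> at the end of this theory.\<close>

definition chromatic_poly :: "'a set \<Rightarrow> 'a set set \<Rightarrow> ('a \<times> 'a) set \<Rightarrow> real poly" where
  "chromatic_poly V E A =
     (THE p. \<forall>t::nat. poly p (real t) = real (num_proper_colorings V E A t))"

text \<open>
  An orientation is represented by the set of all its arcs, that is, the directed edges of the
  graph together with exactly one of \<open>(u, v)\<close>, \<open>(v, u)\<close> for each undirected edge \<open>{u, v}\<close>.
\<close>

definition orientation :: "'a set set \<Rightarrow> ('a \<times> 'a) set \<Rightarrow> ('a \<times> 'a) set \<Rightarrow> bool" where
  "orientation E A D \<longleftrightarrow>
     A \<subseteq> D \<and> D \<subseteq> A \<union> {(u, v). {u, v} \<in> E} \<and>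
     (\<forall>u v. {u, v} \<in> E \<longrightarrow> ((u, v) \<in> D \<longleftrightarrow> (v, u) \<notin> D))"

definition compatible :: "('a \<Rightarrow> nat) \<Rightarrow> ('a \<times> 'a) set \<Rightarrow> bool" where
  "compatible c D \<longleftrightarrow> (\<forall>u v. (u, v) \<in> D \<longrightarrow> c u \<le> c v)"

definition compatible_acyclic_orientations ::
    "'a set set \<Rightarrow> ('a \<times> 'a) set \<Rightarrow> ('a \<Rightarrow> nat) \<Rightarrow> ('a \<times> 'a) set set" where
  "compatible_acyclic_orientations E A c =
     {D. orientation E A D \<and> acyclic D \<and> compatible c D}"

definition proper_onto ::
    "'a set \<Rightarrow> 'a set set \<Rightarrow> ('a \<times> 'a) set \<Rightarrow> nat set \<Rightarrow> ('a \<Rightarrow> nat) set" where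
  "proper_onto V E A S = {c \<in> V \<rightarrow>\<^sub>E S. proper E A c \<and> c ` V = S}"

context mixed_graph
begin

lemma E_vertices: "{v, w} \<in> E \<Longrightarrow> v \<in> V \<and> w \<in> V"
  using E_edges[of "{v, w}"] by (auto simp: doubleton_eq_iff)

lemma proper_transfer:
  assumes h: "strict_mono_on S h" and c: "c ` V \<subseteq> S" and p: "proper E A c"
  shows "proper E A (restrict (h \<circ> c) V)"
proof -
  have inj: "inj_on h S"
    using h by (rule strict_mono_on_imp_inj_on)
  have "restrict (h \<circ> c) V v \<noteq> restrict (h \<circ> c) V w" if "{v, w} \<in> E" for v w
  proof -
    have "v \<in> V" "w \<in> V" "c v \<noteq> c w"
      using E_vertices[OF that] p that by (auto simp: proper_def)
    thus ?thesis
      using c inj by (auto dest: inj_onD)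
  qed
  moreover have "restrict (h \<circ> c) V v < restrict (h \<circ> c) V w" if "(v, w) \<in> A" for v w
  proof -
    have "v \<in> V" "w \<in> V" "c v < c w"
      using A_edges[OF that] p that by (auto simp: proper_def)
    thus ?thesis
      using c h by (auto intro: strict_mono_onD)
  qed
  ultimately show ?thesis
    unfolding proper_def by blast
qed

lemma card_proper_onto_le:
  assumes "finite T" "strict_mono_on S h" "bij_betw h S T"
  shows "card (proper_onto V E A S) \<le> card (proper_onto V E A T)"
proof (rule card_inj_on_le)
  have inj: "inj_on h S"
    using assms(3) by (rule bij_betw_imp_inj_on)
  have hS: "h ` S = T"
    using assms(3) by (rule bij_betw_imp_surj_on)
  show "inj_on (\<lambda>c. restrict (h \<circ> c) V) (proper_onto V E A S)"
  proof (rule inj_onI)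
    fix c d
    assume c: "c \<in> proper_onto V E A S" and d: "d \<in> proper_onto V E A S"
      and eq: "restrict (h \<circ> c) V = restrict (h \<circ> d) V"
    show "c = d"
    proof (rule PiE_ext)
      show "c \<in> V \<rightarrow>\<^sub>E S" "d \<in> V \<rightarrow>\<^sub>E S"
        using c d by (auto simp: proper_onto_def)
      fix v assume v: "v \<in> V"
      have "h (c v) = h (d v)"
        using fun_cong[OF eq, of v] v by simp
      moreover have "c v \<in> S" "d v \<in> S"
        using c d v by (auto simp: proper_onto_def)
      ultimately show "c v = d v"
        using inj by (auto dest: inj_onD)
    qed
  qed
  show "(\<lambda>c. restrict (h \<circ> c) V) ` proper_onto V E A S \<subseteq> proper_onto V E A T"
  proof (rule image_subsetI)
    fix c assume c: "c \<in> proper_onto V E A S"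
    hence cV: "c ` V = S" and p: "proper E A c"
      by (auto simp: proper_onto_def)
    have im: "restrict (h \<circ> c) V ` V = T"
      using hS cV by (metis image_comp image_restrict_eq)
    hence "restrict (h \<circ> c) V \<in> V \<rightarrow>\<^sub>E T"
      by auto
    thus "restrict (h \<circ> c) V \<in> proper_onto V E A T"
      using im proper_transfer[OF assms(2) _ p] cV by (auto simp: proper_onto_def)
  qed
  show "finite (proper_onto V E A T)"
    by (rule finite_subset[of _ "V \<rightarrow>\<^sub>E T"])
       (use finite_PiE[OF finite_V, of "\<lambda>_. T"] assms(1) in \<open>auto simp: proper_onto_def\<close>)
qed

lemma card_proper_onto:
  assumes "finite S"
  shows "card (proper_onto V E A S) = card (proper_onto V E A {..<card S})"
proof (rule antisym)
  obtain h where h: "bij_betw h {..<card S} S" "strict_mono_on {..<card S} h"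
    using ex_bij_betw_strict_mono_card[OF assms] by blast
  show "card (proper_onto V E A {..<card S}) \<le> card (proper_onto V E A S)"
    by (rule card_proper_onto_le[OF assms h(2,1)])
  let ?g = "inv_into {..<card S} h"
  have g: "bij_betw ?g S {..<card S}"
    using h(1) by (rule bij_betw_inv_into)
  have "strict_mono_on S ?g"
  proof (rule strict_mono_onI)
    fix x y assume xy: "x \<in> S" "y \<in> S" "x < y"
    have m: "?g x \<in> {..<card S}" "?g y \<in> {..<card S}"
      using g xy by (auto dest: bij_betw_apply)
    have e: "h (?g x) = x" "h (?g y) = y"
      using bij_betw_inv_into_right[OF h(1)] xy by auto
    show "?g x < ?g y"
    proof (rule ccontr)
      assume "\<not> ?g x < ?g y"
      hence "?g y = ?g x \<or> ?g y < ?g x"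
        by auto
      hence "h (?g y) \<le> h (?g x)"
        using strict_mono_onD[OF h(2) m(2,1)] by auto
      with e xy(3) show False
        by simp
    qed
  qed
  thus "card (proper_onto V E A S) \<le> card (proper_onto V E A {..<card S})"
    using g by (intro card_proper_onto_le) auto
qed

lemma num_proper_colorings_binomial:
  "num_proper_colorings V E A t =
     (\<Sum>k\<le>card V. card (proper_onto V E A {..<k}) * (t choose k))"
proof -
  let ?F = "\<lambda>k. {S. S \<subseteq> {1..t} \<and> card S = k}"
  have fin: "finite S" if "S \<subseteq> {1..t}" for S
    using that finite_subset by blast
  have cV: "card (c ` V) \<le> card V" for c :: "'a \<Rightarrow> nat"
    by (rule card_image_le[OF finite_V])
  have eq: "{c \<in> colorings V t. proper E A c} =
      (\<Union>S\<in>(\<Union>k\<le>card V. ?F k). proper_onto V E A S)"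
  proof (intro equalityI subsetI)
    fix c assume "c \<in> {c \<in> colorings V t. proper E A c}"
    hence c: "c \<in> V \<rightarrow>\<^sub>E {1..t}" "proper E A c"
      by (auto simp: colorings_def)
    have "c ` V \<subseteq> {1..t}"
      using c(1) by auto
    moreover have "c \<in> proper_onto V E A (c ` V)"
      using c by (auto simp: proper_onto_def PiE_iff)
    ultimately show "c \<in> (\<Union>S\<in>(\<Union>k\<le>card V. ?F k). proper_onto V E A S)"
      using cV[of c] by blast
  next
    fix c assume "c \<in> (\<Union>S\<in>(\<Union>k\<le>card V. ?F k). proper_onto V E A S)"
    then obtain S where "S \<subseteq> {1..t}" "c \<in> proper_onto V E A S"
      by blast
    thus "c \<in> {c \<in> colorings V t. proper E A c}"
      by (auto simp: proper_onto_def colorings_def PiE_iff)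
  qed
  have finF: "finite (?F k)" for k
    by (rule finite_subset[of _ "Pow {1..t}"]) auto
  have finP: "finite (proper_onto V E A S)" if "S \<subseteq> {1..t}" for S
    by (rule finite_subset[of _ "V \<rightarrow>\<^sub>E S"])
       (use finite_PiE[OF finite_V, of "\<lambda>_. S"] fin[OF that] in \<open>auto simp: proper_onto_def\<close>)
  have "num_proper_colorings V E A t =
      (\<Sum>S\<in>(\<Union>k\<le>card V. ?F k). card (proper_onto V E A S))"
    unfolding num_proper_colorings_def eq
    by (rule card_UN_disjoint) (use finF finP in \<open>auto simp: proper_onto_def\<close>)
  also have "\<dots> = (\<Sum>k\<le>card V. \<Sum>S\<in>?F k. card (proper_onto V E A S))"
    by (rule sum.UNION_disjoint) (use finF in auto)
  also have "\<dots> = (\<Sum>k\<le>card V. \<Sum>S\<in>?F k. card (proper_onto V E A {..<k}))"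
  proof (intro sum.cong refl)
    fix k S assume "S \<in> ?F k"
    thus "card (proper_onto V E A S) = card (proper_onto V E A {..<k})"
      using card_proper_onto[OF fin, of S] by auto
  qed
  also have "\<dots> = (\<Sum>k\<le>card V. card (proper_onto V E A {..<k}) * (t choose k))"
    using n_subsets[of "{1..t}"] by (simp add: mult.commute)
  finally show ?thesis .
qed

lemma ex1_chromatic_poly:
  "\<exists>!p::real poly. \<forall>t::nat. poly p (real t) = real (num_proper_colorings V E A t)"
proof (rule ex_ex1I)
  define b :: "nat \<Rightarrow> real poly"
    where "b k = smult (1 / fact k) (\<Prod>i<k. [:- real i, 1:])" for k
  have b: "poly (b k) (real t) = real (t choose k)" for k t
    by (simp add: b_def poly_prod binomial_gbinomial gbinomial_prod_rev atLeast0LessThan)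
  have "\<forall>t::nat. poly (\<Sum>k\<le>card V. smult (real (card (proper_onto V E A {..<k}))) (b k)) (real t) =
      real (num_proper_colorings V E A t)"
    by (simp add: num_proper_colorings_binomial poly_sum b)
  thus "\<exists>p::real poly. \<forall>t::nat. poly p (real t) = real (num_proper_colorings V E A t)"
    by blast
next
  fix p q :: "real poly"
  assume p: "\<forall>t::nat. poly p (real t) = real (num_proper_colorings V E A t)"
    and q: "\<forall>t::nat. poly q (real t) = real (num_proper_colorings V E A t)"
  have "range real \<subseteq> {x. poly (p - q) x = 0}"
    using p q by auto
  moreover have "infinite (range real)"
    by (simp add: finite_image_iff)
  ultimately have "p - q = 0"
    using poly_roots_finite finite_subset by blast
  thus "p = q"
    by simp
qed

end

end

theory Submission
  imports Defs
begin

text \<open>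
  The reciprocity is first proved one acyclic orientation at a time. A proper coloring \<open>c\<close> never
  agrees on an edge, so it picks out exactly one orientation along which it strictly increases,
  and that orientation is acyclic. Hence \<open>\<chi>\<close> is the sum, over the acyclic orientations \<open>D\<close>, of the
  number of colorings that increase strictly along \<open>D\<close>; interchanging the summations on the other
  side gives the sum, over the same \<open>D\<close>, of the number of colorings that increase weakly along \<open>D\<close>.
  It remains to prove the reciprocity between strict and weak colorings of one acyclic digraph \<open>D\<close>,
  which is Stanley's reciprocity for order polynomials.

  Write \<open>s(W, t)\<close> and \<open>w(W, t)\<close> for the numbers of strict and weak \<open>t\<close>-colorings of the subgraph
  that \<open>D\<close> induces on a vertex set \<open>W\<close>, and let \<open>I\<close> range over the sets of sinks of that subgraph.
  In a strict \<open>(t+1)\<close>-coloring the top color class is such a set, and removing it leaves a strict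
  \<open>t\<close>-coloring (lemma \<open>card_strict_Suc\<close>):
    \<open>s(W, t+1) = (\<Sum>I. s(W - I, t))\<close>.
  In a weak coloring that uses the top color some sink has this color, so inclusion-exclusion
  over the sinks with the top color counts the colorings avoiding it (lemma \<open>card_weak_alternating\<close>):
    \<open>w(W, t) = (\<Sum>I. (-1)^|I| w(W - I, t+1))\<close>.
  The first recursion is an identity of polynomials in \<open>t\<close>. Evaluated at negative arguments, it
  is the second one up to the sign \<open>(-1)^|W|\<close>. Solved for the term with \<open>I = {}\<close>, either one
  determines the value for \<open>W\<close> and \<open>t + 1\<close> from values for proper subsets of \<open>W\<close> or for \<open>t\<close>, so
  both have the same solution.
\<close>

section \<open>Colorings that increase along a digraph\<close>

text \<open>
  Strict and weak colorings are treated together, with \<open>R\<close> being \<open>(<)\<close> or \<open>(\<le>)\<close>. Only the arcs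
  inside \<open>W\<close> count, so that vertices can be removed while the digraph stays fixed.
\<close>

definition increasing_colorings ::
    "(nat \<Rightarrow> nat \<Rightarrow> bool) \<Rightarrow> ('a \<times> 'a) set \<Rightarrow> 'a set \<Rightarrow> nat \<Rightarrow> ('a \<Rightarrow> nat) set" where
  "increasing_colorings R D W t =
     {c \<in> colorings W t. \<forall>u\<in>W. \<forall>v\<in>W. (u, v) \<in> D \<longrightarrow> R (c u) (c v)}"

definition sinks :: "('a \<times> 'a) set \<Rightarrow> 'a set \<Rightarrow> 'a set" where
  "sinks D W = {u \<in> W. \<forall>v\<in>W. (u, v) \<notin> D}"

lemma sinks_subset: "sinks D W \<subseteq> W"
  by (auto simp: sinks_def)

lemma finite_colorings: "finite W \<Longrightarrow> finite (colorings W t)"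
  by (simp add: colorings_def finite_PiE)

lemma finite_increasing_colorings: "finite W \<Longrightarrow> finite (increasing_colorings R D W t)"
  by (simp add: increasing_colorings_def finite_colorings)

text \<open>
  A sink imposes a condition only on its predecessors, and that condition is void when the sink
  has the top color. Giving all of \<open>I\<close> the top color thus extends every increasing coloring of
  \<open>W - I\<close>. The strict case needs the colors on \<open>W - I\<close> to stay below the top color (\<open>s = t\<close>), the
  weak case does not (\<open>s = t + 1\<close>).
\<close>

lemma card_top_colored_sinks:
  assumes I: "I \<subseteq> sinks D W" and s: "s \<le> Suc t"
    and top: "\<And>a. a \<in> {1..s} \<Longrightarrow> R a (Suc t)"
  shows "card {c \<in> increasing_colorings R D W (Suc t).
            (\<forall>v\<in>I. c v = Suc t) \<and> (\<forall>v\<in>W - I. c v \<le> s)} =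
         card (increasing_colorings R D (W - I) s)"
proof -
  let ?L = "{c \<in> increasing_colorings R D W (Suc t).
            (\<forall>v\<in>I. c v = Suc t) \<and> (\<forall>v\<in>W - I. c v \<le> s)}"
  let ?M = "increasing_colorings R D (W - I) s"
  let ?f = "\<lambda>c. restrict c (W - I)"
  let ?g = "\<lambda>c. \<lambda>v. if v \<in> I then Suc t else c v"
  have IW: "I \<subseteq> W" and noarc: "\<And>u v. u \<in> I \<Longrightarrow> v \<in> W \<Longrightarrow> (u, v) \<notin> D"
    using I by (auto simp: sinks_def)
  have "bij_betw ?f ?L ?M"
  proof (rule bij_betw_byWitness[where f' = ?g])
    show "\<forall>c\<in>?L. ?g (?f c) = c"
      using IW by (auto simp: increasing_colorings_def colorings_def PiE_iff extensional_def fun_eq_iff)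
    show "\<forall>c\<in>?M. ?f (?g c) = c"
      by (auto simp: increasing_colorings_def colorings_def PiE_iff extensional_def fun_eq_iff)
    show "?f ` ?L \<subseteq> ?M"
      by (auto simp: increasing_colorings_def colorings_def PiE_iff Pi_iff)
    show "?g ` ?M \<subseteq> ?L"
    proof (rule image_subsetI)
      fix c assume c: "c \<in> ?M"
      hence range: "c v \<in> {1..s}" if "v \<in> W - I" for v
        using that by (auto simp: increasing_colorings_def colorings_def PiE_iff)
      have "?g c \<in> colorings W (Suc t)"
        using c IW s unfolding increasing_colorings_def colorings_def
        by (fastforce simp: PiE_iff extensional_def)
      moreover have "R (?g c u) (?g c v)" if "u \<in> W" "v \<in> W" "(u, v) \<in> D" for u v
        using that c noarc[of u v] top[OF range, of u]
        by (auto simp: increasing_colorings_def)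
      ultimately show "?g c \<in> ?L"
        using range by (auto simp: increasing_colorings_def)
    qed
  qed
  thus ?thesis
    by (rule bij_betw_same_card)
qed

text \<open>
  Sorting the strict colorings by their top color class loses nothing, because a vertex with the
  top color has no successor to carry a larger one.
\<close>

lemma card_strict_Suc:
  assumes W: "finite W"
  shows "card (increasing_colorings (<) D W (Suc t)) =
    (\<Sum>I\<in>Pow (sinks D W). card (increasing_colorings (<) D (W - I) t))"
proof -
  let ?C = "increasing_colorings (<) D W (Suc t)"
  let ?top = "\<lambda>c. {v \<in> W. c v = Suc t}"
  have range: "c v \<le> Suc t" if "c \<in> ?C" "v \<in> W" for c v
    using that by (auto simp: increasing_colorings_def colorings_def PiE_iff)
  have finS: "finite (sinks D W)"
    using finite_subset[OF sinks_subset W] .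
  have top_sinks: "?top c \<in> Pow (sinks D W)" if c: "c \<in> ?C" for c
  proof -
    have "(u, v) \<notin> D" if "u \<in> ?top c" "v \<in> W" for u v
    proof
      assume "(u, v) \<in> D"
      hence "c u < c v"
        using c that by (auto simp: increasing_colorings_def)
      thus False
        using range[OF c that(2)] that(1) by simp
    qed
    thus ?thesis
      by (auto simp: sinks_def)
  qed
  have "card ?C = (\<Sum>I\<in>Pow (sinks D W). card {c \<in> ?C. ?top c = I})"
    using sum.group[of ?C "Pow (sinks D W)" ?top "\<lambda>_. 1::nat"]
      finite_increasing_colorings[OF W] top_sinks finS by (simp add: image_subset_iff)
  also have "\<dots> = (\<Sum>I\<in>Pow (sinks D W). card (increasing_colorings (<) D (W - I) t))"
  proof (rule sum.cong[OF refl])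
    fix I assume I: "I \<in> Pow (sinks D W)"
    hence IW: "I \<subseteq> W"
      using sinks_subset by fastforce
    have "{c \<in> ?C. ?top c = I} =
        {c \<in> ?C. (\<forall>v\<in>I. c v = Suc t) \<and> (\<forall>v\<in>W - I. c v \<le> t)}"
      (is "?L = ?M")
    proof (intro equalityI subsetI)
      fix c assume "c \<in> ?L"
      thus "c \<in> ?M"
        using range[of c] by (auto simp: le_Suc_eq)
    next
      fix c assume c: "c \<in> ?M"
      have "v \<in> I" if "v \<in> W" "c v = Suc t" for v
        using c that by force
      thus "c \<in> ?L"
        using c IW by auto
    qed
    thus "card {c \<in> ?C. ?top c = I} = card (increasing_colorings (<) D (W - I) t)"
      using card_top_colored_sinks[of I D W t t "(<)"] I by simp
  qed
  finally show ?thesis .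
qed

text \<open>The binomial expansion of \<open>(1 - 1)^|T|\<close>.\<close>

lemma sum_Pow_alternating:
  assumes "finite T"
  shows "(\<Sum>I\<in>Pow T. (- 1) ^ card I :: real) = (if T = {} then 1 else 0)"
  using prod_diff_conv_sum[OF assms, of "\<lambda>_. 1::real" "\<lambda>_. 1"] assms
  by (simp add: power_0_left)

text \<open>
  Each weak coloring \<open>c\<close> with \<open>t + 1\<close> colors contributes the alternating sum over the subsets of
  the set \<open>T\<close> of sinks with the top color, which vanishes unless \<open>T\<close> is empty. As a vertex with
  the top color that is last along \<open>D\<close> among such vertices must be a sink, \<open>T\<close> is empty only if \<open>c\<close>
  avoids the top color.
\<close>

lemma card_weak_alternating:
  assumes W: "finite W" and D: "finite D" "acyclic D"
  shows "real (card (increasing_colorings (\<le>) D W t)) =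
    (\<Sum>I\<in>Pow (sinks D W). (- 1) ^ card I * real (card (increasing_colorings (\<le>) D (W - I) (Suc t))))"
proof -
  let ?C = "increasing_colorings (\<le>) D W (Suc t)"
  let ?T = "\<lambda>c. {v \<in> sinks D W. c v = Suc t}"
  have range: "c v \<le> Suc t" if "c \<in> ?C" "v \<in> W" for c v
    using that by (auto simp: increasing_colorings_def colorings_def PiE_iff)
  have finS: "finite (sinks D W)"
    using finite_subset[OF sinks_subset W] .
  have finC: "finite ?C"
    using W by (rule finite_increasing_colorings)
  have avoid: "c v \<le> t" if c: "c \<in> ?C" "?T c = {}" and v: "v \<in> W" for c v
  proof (rule ccontr)
    assume "\<not> c v \<le> t"
    hence "v \<in> {v \<in> W. c v = Suc t}"
      using range[OF c(1) v] v by simp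
    \<comment> \<open>Acyclicity gives a last vertex among those with the top color.\<close>
    then obtain u where u: "u \<in> W" "c u = Suc t"
      and last: "\<And>y. (u, y) \<in> D \<Longrightarrow> y \<in> W \<Longrightarrow> c y \<noteq> Suc t"
      using wfE_min[OF finite_acyclic_wf_converse[OF D], of v "{v \<in> W. c v = Suc t}"] by auto
    have "(u, y) \<notin> D" if "y \<in> W" for y
    proof
      assume "(u, y) \<in> D"
      moreover from this have "c u \<le> c y"
        using c(1) u that by (auto simp: increasing_colorings_def)
      ultimately show False
        using range[OF c(1) that] last that u by fastforce
    qed
    hence "u \<in> ?T c"
      using u by (auto simp: sinks_def)
    thus False
      using c by blast
  qed
  have weak: "increasing_colorings (\<le>) D W t = {c \<in> ?C. ?T c = {}}"
  proof (intro equalityI subsetI)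
    fix c assume c: "c \<in> increasing_colorings (\<le>) D W t"
    hence "c v \<in> {1..t}" if "v \<in> W" for v
      using that by (auto simp: increasing_colorings_def colorings_def PiE_iff)
    moreover from this have "c \<in> ?C"
      using c by (fastforce simp: increasing_colorings_def colorings_def PiE_iff)
    ultimately show "c \<in> {c \<in> ?C. ?T c = {}}"
      using sinks_subset[of D W] by fastforce
  next
    fix c assume "c \<in> {c \<in> ?C. ?T c = {}}"
    thus "c \<in> increasing_colorings (\<le>) D W t"
      using avoid[of c] by (auto simp: increasing_colorings_def colorings_def PiE_iff)
  qed
  have "(\<Sum>I\<in>Pow (sinks D W). (- 1) ^ card I * real (card (increasing_colorings (\<le>) D (W - I) (Suc t))))
      = (\<Sum>I\<in>Pow (sinks D W). \<Sum>c | c \<in> ?C \<and> I \<subseteq> ?T c. (- 1) ^ card I)"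
  proof (rule sum.cong[OF refl])
    fix I assume I: "I \<in> Pow (sinks D W)"
    have "{c \<in> ?C. I \<subseteq> ?T c} =
        {c \<in> ?C. (\<forall>v\<in>I. c v = Suc t) \<and> (\<forall>v\<in>W - I. c v \<le> Suc t)}"
      using I range by blast
    thus "(- 1) ^ card I * real (card (increasing_colorings (\<le>) D (W - I) (Suc t))) =
        (\<Sum>c | c \<in> ?C \<and> I \<subseteq> ?T c. (- 1) ^ card I)"
      using card_top_colored_sinks[of I D W "Suc t" t "(\<le>)"] I by simp
  qed
  also have "\<dots> = (\<Sum>c\<in>?C. \<Sum>I | I \<in> Pow (sinks D W) \<and> I \<subseteq> ?T c. (- 1) ^ card I)"
    using finS finC by (intro sum.swap_restrict) auto
  also have "\<dots> = (\<Sum>c\<in>?C. if ?T c = {} then 1 else 0)"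
  proof (rule sum.cong[OF refl])
    fix c
    have "{I. I \<in> Pow (sinks D W) \<and> I \<subseteq> ?T c} = Pow (?T c)"
      by blast
    thus "(\<Sum>I | I \<in> Pow (sinks D W) \<and> I \<subseteq> ?T c. (- 1) ^ card I) =
        (if ?T c = {} then 1 else 0 :: real)"
      using sum_Pow_alternating[of "?T c"] finS by simp
  qed
  also have "\<dots> = real (card {c \<in> ?C. ?T c = {}})"
    using sum.inter_filter[OF finC, of "\<lambda>_. 1::real" "\<lambda>c. ?T c = {}"] by simp
  finally show ?thesis
    using weak by simp
qed

section \<open>Reciprocity for an acyclic digraph\<close>

text \<open>
  The strict colorings of \<open>W\<close> are the proper colorings of a mixed graph without undirected edges,
  which makes their number a polynomial.
\<close>

lemma poly_chromatic_poly:
  assumes "mixed_graph V E A"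
  shows "poly (chromatic_poly V E A) (real t) = real (num_proper_colorings V E A t)"
  using theI'[OF mixed_graph.ex1_chromatic_poly[OF assms]] unfolding chromatic_poly_def by blast

lemma chromatic_poly_unique:
  assumes "mixed_graph V E A"
    and "\<And>t. poly p (real t) = real (num_proper_colorings V E A t)"
  shows "chromatic_poly V E A = p"
  unfolding chromatic_poly_def
  by (rule the1_equality[OF mixed_graph.ex1_chromatic_poly[OF assms(1)]]) (use assms(2) in blast)

lemma mixed_graph_acyclic_digraph:
  assumes "finite W" "acyclic D"
  shows "mixed_graph W {} (Restr D W)"
proof
  show "(w, v) \<notin> Restr D W" if "(v, w) \<in> Restr D W" for v w
    using assms(2) that unfolding acyclic_def by (blast intro: trancl_into_trancl)
qed (use assms in \<open>auto simp: acyclic_def\<close>)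

lemma num_proper_colorings_digraph:
  "num_proper_colorings W {} (Restr D W) t = card (increasing_colorings (<) D W t)"
  unfolding num_proper_colorings_def increasing_colorings_def proper_def
  by (rule arg_cong[of _ _ card]) blast

lemma poly_strict:
  assumes "finite W" "acyclic D"
  shows "poly (chromatic_poly W {} (Restr D W)) (real t) = real (card (increasing_colorings (<) D W t))"
  using poly_chromatic_poly[OF mixed_graph_acyclic_digraph[OF assms]]
  by (simp add: num_proper_colorings_digraph)

text \<open>
  The recursion of lemma \<open>card_strict_Suc\<close> extends to real arguments, because it relates
  polynomials that agree at all natural numbers.
\<close>

lemma poly_strict_recursion:
  assumes W: "finite W" and D: "acyclic D"
  shows "poly (chromatic_poly W {} (Restr D W)) (x + 1) =
    (\<Sum>I\<in>Pow (sinks D W). poly (chromatic_poly (W - I) {} (Restr D (W - I))) x)"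
proof -
  let ?P = "\<lambda>W. chromatic_poly W {} (Restr D W)"
  let ?p = "?P W \<circ>\<^sub>p [:1, 1:] - (\<Sum>I\<in>Pow (sinks D W). ?P (W - I))"
  have "poly ?p (real t) = 0" for t
  proof -
    have "poly (?P W) (1 + real t) = real (card (increasing_colorings (<) D W (Suc t)))"
      using poly_strict[OF assms, of "Suc t"] by simp
    thus ?thesis
      using W D by (simp add: poly_pcompose poly_sum poly_strict card_strict_Suc)
  qed
  hence "range real \<subseteq> {x. poly ?p x = 0}"
    by auto
  moreover have "infinite (range real)"
    by (simp add: finite_image_iff)
  ultimately have "?p = 0"
    using poly_roots_finite finite_subset by blast
  hence "poly ?p x = 0"
    by simp
  thus ?thesis
    by (simp add: poly_pcompose poly_sum add.commute)
qed

text \<open>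
  Outer induction on \<open>t\<close>, inner induction on \<open>W\<close>: at \<open>-(t+1)\<close> the polynomial recursion contains
  the wanted value as its term for \<open>I = {}\<close>, while the other terms belong to proper subsets of \<open>W\<close>
  and the left-hand side to the argument \<open>-t\<close>. Without colors (\<open>t = 0\<close>) strict and weak colorings
  are the same, and there are none unless \<open>W\<close> is empty.
\<close>

theorem acyclic_digraph_reciprocity:
  assumes W: "finite W" and D: "finite D" "acyclic D"
  shows "poly (chromatic_poly W {} (Restr D W)) (- real t) =
    (- 1) ^ card W * real (card (increasing_colorings (\<le>) D W t))"
  using W
proof (induction t arbitrary: W)
  case 0
  have "increasing_colorings (<) D W 0 = increasing_colorings (\<le>) D W 0"
    by (cases "W = {}") (auto simp: increasing_colorings_def colorings_def PiE_eq_empty_iff)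
  moreover have "increasing_colorings (\<le>) D W 0 = {}" if "W \<noteq> {}"
    using that by (auto simp: increasing_colorings_def colorings_def PiE_eq_empty_iff)
  ultimately show ?case
    using poly_strict[OF 0 D(2), of 0] by (cases "W = {}") simp_all
next
  case (Suc t)
  note at_t = Suc.IH
  let ?P = "\<lambda>W. poly (chromatic_poly W {} (Restr D W))"
  let ?w = "\<lambda>W t. real (card (increasing_colorings (\<le>) D W t))"
  show ?case
    using Suc.prems
  proof (induction W rule: finite_psubset_induct)
    case (psubset W)
    let ?S = "Pow (sinks D W)"
    have fin: "finite ?S"
      using finite_subset[OF sinks_subset psubset.hyps] by simp
    \<comment> \<open>Factoring out the sign of \<open>W\<close> leaves the sign of \<open>I\<close>, which turns the polynomial recursion
      into the inclusion-exclusion formula for weak colorings.\<close>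
    have "?P (W - I) (- real (Suc t)) = (- 1) ^ card W * ((- 1) ^ card I * ?w (W - I) (Suc t))"
      if I: "I \<in> ?S - {{}}" for I
    proof -
      have "I \<subseteq> W" "I \<noteq> {}"
        using I sinks_subset[of D W] by auto
      hence "?P (W - I) (- real (Suc t)) = (- 1) ^ card (W - I) * ?w (W - I) (Suc t)"
        using psubset.IH[of "W - I"] by blast
      moreover have "card W = card (W - I) + card I"
        using \<open>I \<subseteq> W\<close> psubset.hyps by (metis card_Diff_subset card_mono finite_subset le_add_diff_inverse2)
      ultimately show ?thesis
        by (simp add: power_add)
    qed
    hence rest: "(\<Sum>I\<in>?S - {{}}. ?P (W - I) (- real (Suc t))) =
        (- 1) ^ card W * (\<Sum>I\<in>?S - {{}}. (- 1) ^ card I * ?w (W - I) (Suc t))"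
      by (simp add: sum_distrib_left)
    have "?P W (- real t) = (\<Sum>I\<in>?S. ?P (W - I) (- real (Suc t)))"
      using poly_strict_recursion[OF psubset.hyps D(2), of "- real (Suc t)"] by simp
    also have "\<dots> = ?P W (- real (Suc t)) + (\<Sum>I\<in>?S - {{}}. ?P (W - I) (- real (Suc t)))"
      using sum.remove[OF fin, of "{}" "\<lambda>I. ?P (W - I) (- real (Suc t))"] by simp
    finally have P: "?P W (- real t) = ?P W (- real (Suc t)) +
        (- 1) ^ card W * (\<Sum>I\<in>?S - {{}}. (- 1) ^ card I * ?w (W - I) (Suc t))"
      using rest by simp
    have "?w W t = (\<Sum>I\<in>?S. (- 1) ^ card I * ?w (W - I) (Suc t))"
      by (rule card_weak_alternating[OF psubset.hyps D])
    also have "\<dots> = ?w W (Suc t) + (\<Sum>I\<in>?S - {{}}. (- 1) ^ card I * ?w (W - I) (Suc t))"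
      using sum.remove[OF fin, of "{}" "\<lambda>I. (- 1) ^ card I * ?w (W - I) (Suc t)"] by simp
    finally have w: "?w W t = \<dots>" .
    show ?case
      using P w at_t[OF psubset.hyps] by (simp add: algebra_simps)
  qed
qed

section \<open>Decomposition over acyclic orientations\<close>

lemma orientation_subset:
  assumes "mixed_graph V E A" "orientation E A D"
  shows "D \<subseteq> V \<times> V"
proof -
  have "D \<subseteq> A \<union> {(u, v). {u, v} \<in> E}"
    using assms(2) by (simp add: orientation_def)
  thus ?thesis
    using mixed_graph.E_vertices[OF assms(1)] mixed_graph.A_edges[OF assms(1)] by fast
qed

lemma finite_acyclic_orientations:
  assumes "mixed_graph V E A"
  shows "finite {D. orientation E A D \<and> acyclic D}"
  by (rule finite_subset[of _ "Pow (V \<times> V)"])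
     (use orientation_subset[OF assms] mixed_graph.finite_V[OF assms] in auto)

lemma strictly_increasing_acyclic:
  fixes c :: "'a \<Rightarrow> nat"
  assumes "\<And>u v. (u, v) \<in> D \<Longrightarrow> c u < c v"
  shows "acyclic D"
proof -
  have "c u < c v" if "(u, v) \<in> D\<^sup>+" for u v
    using that by induction (auto dest: assms intro: less_trans)
  thus ?thesis
    unfolding acyclic_def by blast
qed

text \<open>Every edge is oriented towards its larger color, so there is no choice.\<close>

lemma orientation_strict_eq:
  fixes c :: "'a \<Rightarrow> nat"
  assumes D: "orientation E A D" and c: "\<And>u v. (u, v) \<in> D \<Longrightarrow> c u < c v"
  shows "D = A \<union> {(u, v). {u, v} \<in> E \<and> c u < c v}"
proof -
  have "A \<subseteq> D" and sub: "D \<subseteq> A \<union> {(u, v). {u, v} \<in> E}"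
    using D by (simp_all add: orientation_def)
  moreover have "(u, v) \<in> D" if "{u, v} \<in> E" "c u < c v" for u v
  proof -
    have "(u, v) \<in> D \<longleftrightarrow> (v, u) \<notin> D"
      using D that(1) by (simp add: orientation_def)
    thus ?thesis
      using c[of v u] that(2) by auto
  qed
  moreover have "{u, v} \<in> E \<and> c u < c v" if "(u, v) \<in> D - A" for u v
    using that sub c[of u v] by auto
  ultimately show ?thesis
    by auto
qed

text \<open>
  Orienting towards the larger color yields an acyclic digraph, since colors grow along every
  path. By simplicity of the mixed graph an undirected edge does not have one of its orientations
  among the directed edges already.
\<close>

lemma proper_colorings_decomposition:
  assumes G: "mixed_graph V E A"
  shows "{c \<in> colorings V t. proper E A c} =
    (\<Union>D\<in>{D. orientation E A D \<and> acyclic D}. increasing_colorings (<) D V t)"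
proof (intro equalityI subsetI)
  fix c assume "c \<in> {c \<in> colorings V t. proper E A c}"
  hence c: "c \<in> colorings V t" "proper E A c"
    by auto
  let ?D = "A \<union> {(u, v). {u, v} \<in> E \<and> c u < c v}"
  have ori: "orientation E A ?D"
    unfolding orientation_def
  proof (intro conjI allI impI)
    fix u v assume e: "{u, v} \<in> E"
    hence "(u, v) \<notin> A" "(v, u) \<notin> A" "c u \<noteq> c v"
      using mixed_graph.E_A_simple[OF G, of u v] mixed_graph.E_A_simple[OF G, of v u] c(2)
      by (auto simp: proper_def insert_commute)
    thus "((u, v) \<in> ?D) = ((v, u) \<notin> ?D)"
      using e by (auto simp: insert_commute)
  qed auto
  have less: "c u < c v" if "(u, v) \<in> ?D" for u v
    using that c(2) by (auto simp: proper_def)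
  hence "acyclic ?D"
    by (rule strictly_increasing_acyclic)
  with ori have "?D \<in> {D. orientation E A D \<and> acyclic D}"
    by simp
  moreover have "c \<in> increasing_colorings (<) ?D V t"
    using c(1) less unfolding increasing_colorings_def by blast
  ultimately show "c \<in> (\<Union>D\<in>{D. orientation E A D \<and> acyclic D}. increasing_colorings (<) D V t)"
    by (rule UN_I)
next
  fix c assume "c \<in> (\<Union>D\<in>{D. orientation E A D \<and> acyclic D}. increasing_colorings (<) D V t)"
  then obtain D where D: "orientation E A D" and c: "c \<in> increasing_colorings (<) D V t"
    by blast
  have less: "c u < c v" if "(u, v) \<in> D" for u v
    using that c orientation_subset[OF G D] by (auto simp: increasing_colorings_def)
  have "c v \<noteq> c w" if "{v, w} \<in> E" for v w
  proof -
    have "(v, w) \<in> D \<or> (w, v) \<in> D"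
      using D that unfolding orientation_def by blast
    thus ?thesis
      using less by fastforce
  qed
  moreover have "c v < c w" if "(v, w) \<in> A" for v w
    using D that less unfolding orientation_def by blast
  ultimately show "c \<in> {c \<in> colorings V t. proper E A c}"
    using c by (auto simp: proper_def increasing_colorings_def)
qed

text \<open>
  The union above is disjoint because a coloring that increases strictly along an orientation
  determines it; counting then gives an identity of polynomials.
\<close>

lemma chromatic_poly_decomposition:
  assumes G: "mixed_graph V E A"
  shows "chromatic_poly V E A =
    (\<Sum>D | orientation E A D \<and> acyclic D. chromatic_poly V {} (Restr D V))"
proof (rule chromatic_poly_unique[OF G])
  fix t
  let ?O = "{D. orientation E A D \<and> acyclic D}"
  have V: "finite V"
    by (rule mixed_graph.finite_V[OF G])
  have disjoint: "increasing_colorings (<) D V t \<inter> increasing_colorings (<) D' V t = {}"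
    if "D \<in> ?O" "D' \<in> ?O" "D \<noteq> D'" for D D'
  proof (rule ccontr)
    assume "increasing_colorings (<) D V t \<inter> increasing_colorings (<) D' V t \<noteq> {}"
    then obtain c where "c \<in> increasing_colorings (<) D V t" "c \<in> increasing_colorings (<) D' V t"
      by blast
    moreover have "D \<subseteq> V \<times> V" "D' \<subseteq> V \<times> V"
      using that orientation_subset[OF G] by auto
    ultimately have "c u < c v" if "(u, v) \<in> D \<union> D'" for u v
      using that by (auto simp: increasing_colorings_def)
    hence "D = A \<union> {(u, v). {u, v} \<in> E \<and> c u < c v}" "D' = A \<union> {(u, v). {u, v} \<in> E \<and> c u < c v}"
      using that orientation_strict_eq[of E A D c] orientation_strict_eq[of E A D' c] by auto
    thus False
      using \<open>D \<noteq> D'\<close> by simp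
  qed
  have "num_proper_colorings V E A t = (\<Sum>D\<in>?O. card (increasing_colorings (<) D V t))"
    unfolding num_proper_colorings_def proper_colorings_decomposition[OF G]
    by (rule card_UN_disjoint)
       (use finite_acyclic_orientations[OF G] finite_increasing_colorings[OF V] disjoint in auto)
  thus "poly (\<Sum>D\<in>?O. chromatic_poly V {} (Restr D V)) (real t) =
      real (num_proper_colorings V E A t)"
    using V by (simp add: poly_sum poly_strict)
qed

lemma sum_card_compatible_acyclic_orientations:
  assumes G: "mixed_graph V E A"
  shows "(\<Sum>c\<in>colorings V t. card (compatible_acyclic_orientations E A c)) =
    (\<Sum>D | orientation E A D \<and> acyclic D. card (increasing_colorings (\<le>) D V t))"
proof -
  let ?O = "{D. orientation E A D \<and> acyclic D}"
  have "(\<Sum>c\<in>colorings V t. card (compatible_acyclic_orientations E A c)) =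
      (\<Sum>c\<in>colorings V t. \<Sum>D | D \<in> ?O \<and> compatible c D. 1)"
    by (simp add: compatible_acyclic_orientations_def conj_assoc)
  also have "\<dots> = (\<Sum>D\<in>?O. \<Sum>c | c \<in> colorings V t \<and> compatible c D. 1)"
    by (rule sum.swap_restrict)
       (use finite_colorings[OF mixed_graph.finite_V[OF G]] finite_acyclic_orientations[OF G] in auto)
  also have "\<dots> = (\<Sum>D\<in>?O. card (increasing_colorings (\<le>) D V t))"
  proof (rule sum.cong[OF refl])
    fix D assume "D \<in> ?O"
    hence "D \<subseteq> V \<times> V"
      using orientation_subset[OF G] by blast
    hence "{c. c \<in> colorings V t \<and> compatible c D} = increasing_colorings (\<le>) D V t"
      unfolding increasing_colorings_def compatible_def by blast
    thus "(\<Sum>c | c \<in> colorings V t \<and> compatible c D. 1) = card (increasing_colorings (\<le>) D V t)"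
      by simp
  qed
  finally show ?thesis .
qed

theorem theorem2:
  fixes V :: "'a set" and E :: "'a set set" and A :: "('a \<times> 'a) set" and t :: nat
  assumes "mixed_graph V E A"
  shows "(- 1) ^ card V * poly (chromatic_poly V E A) (- real t) =
    real (\<Sum>c\<in>colorings V t. card (compatible_acyclic_orientations E A c))"
proof -
  let ?O = "{D. orientation E A D \<and> acyclic D}"
  have V: "finite V"
    by (rule mixed_graph.finite_V[OF assms])
  have "poly (chromatic_poly V {} (Restr D V)) (- real t) =
      (- 1) ^ card V * real (card (increasing_colorings (\<le>) D V t))" if "D \<in> ?O" for D
  proof (rule acyclic_digraph_reciprocity[OF V])
    show "finite D"
      using that orientation_subset[OF assms, of D] V finite_subset by blast
    show "acyclic D"
      using that by simp
  qed
  hence "poly (chromatic_poly V E A) (- real t) =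
      (- 1) ^ card V * (\<Sum>D\<in>?O. real (card (increasing_colorings (\<le>) D V t)))"
    by (simp add: chromatic_poly_decomposition[OF assms] poly_sum sum_distrib_left)
  thus ?thesis
    by (simp add: sum_card_compatible_acyclic_orientations[OF assms] flip: mult.assoc power_add)
qed

end
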